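(* Let $\mathcal{Q}=\{C,F,N_1,N_2,N_3\}$ be the set of five subgroups of $SL_3(\mathbb{R})$ and $\mathcal{TQ}=\{TC,TF,TN_1,TN_2,TN_3\}$ the set of five configurations in $\mathbb{R}P^2$ described in the context, with $\mathcal{TQ}$ partially ordered by inclusion. There is a bijection $\theta:\mathcal{Q}\to\mathcal{TQ}$ defined by: $\theta(G)=T$ if and only if 1. $G$ preserves each element of $T$ (i.e. maps each point and each line belonging to $T$ to itself), and 2. $T$ is maximal, in the partial order on $\mathcal{TQ}$, subject to condition 1.
   Context: The elements of $\mathcal{Q}$ are the following subgroups of $SL_3(\mathbb{R})$, acting on $\mathbb{R}P^2$ by left multiplication on column vectors, where $a,b$ range over the positive reals and $s,t$ over $\mathbb{R}$: $$C=\left\{\begin{pmatrix}a&0&0\\0&b&0\\0&0&\frac1{ab}\end{pmatrix}\right\},\quad F=\left\{\begin{pmatrix}a&t&0\\0&a&0\\0&0&\frac1{a^2}\end{pmatrix}\right\},\quad N_1=\left\{\begin{pmatrix}1&s&t\\0&1&s\\0&0&1\end{pmatrix}\right\},$$ $$N_2=\left\{\begin{pmatrix}1&s&t\\0&1&0\\0&0&1\end{pmatrix}\right\},\quad N_3=\left\{\begin{pmatrix}1&0&t\\0&1&s\\0&0&1\end{pmatrix}\right\}.$$ A configuration is a finite set each element of which is a point of $\mathbb{R}P^2$ or a projective line in $\mathbb{R}P^2$. Let $e_1,e_2,e_3$ be the standard basis of $\mathbb{R}^3$ and write $\langle u,v\rangle$ for the projective line through $[u]$ and $[v]$. The five configurations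 are: - $TC$: three points in general position and the three lines joining them, $TC=\{[e_1],[e_2],[e_3],\langle e_1,e_2\rangle,\langle e_1,e_3\rangle,\langle e_2,e_3\rangle\}$. - $TF$: two points, the line through both, and a second line through one of them, $TF=\{[e_1],[e_3],\langle e_1,e_3\rangle,\langle e_1,e_2\rangle\}$. - $TN_1$: a line and one point on it, $TN_1=\{[e_1],\langle e_1,e_2\rangle\}$. - $TN_2$: one point and three distinct lines through it, $TN_2=\{[e_1],\langle e_1,e_2\rangle,\langle e_1,e_3\rangle,\langle e_1,e_2+e_3\rangle\}$. - $TN_3$: one line and three distinct points on it, $TN_3=\{\langle e_1,e_2\rangle,[e_1],[e_2],[e_1+e_2]\}$. *)

theory Defs
  imports "HOL-Analysis.Analysis" "HOL-Algebra.Group"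
begin

text \<open>
  A point of \<open>\<real>P\<^sup>2\<close> is a one-dimensional linear subspace of \<open>\<real>\<^sup>3\<close>; a projective line is the
  set of all points contained in a fixed two-dimensional subspace.
\<close>

definition RP2 :: "(real^3) set set" where
  "RP2 = {P. subspace P \<and> dim P = 1}"

definition pt :: "real^3 \<Rightarrow> (real^3) set" where
  "pt v = span {v}"

definition line_through :: "real^3 \<Rightarrow> real^3 \<Rightarrow> (real^3) set set" where
  "line_through u v = {P \<in> RP2. P \<subseteq> span {u, v}}"

definition proj_lines :: "(real^3) set set set" where
  "proj_lines = {{P \<in> RP2. P \<subseteq> W} | W. subspace W \<and> dim W = 2}"

text \<open>
  The tag separates the two kinds of elements a configuration may have.
\<close>

datatype proj_elem = Point "(real^3) set" | Line "(real^3) set set"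

definition configuration :: "proj_elem set \<Rightarrow> bool" where
  "configuration T \<longleftrightarrow> finite T \<and> T \<subseteq> Point ` RP2 \<union> Line ` proj_lines"

definition act_pt :: "real^3^3 \<Rightarrow> (real^3) set \<Rightarrow> (real^3) set" where
  "act_pt A P = (\<lambda>x. A *v x) ` P"

fun act :: "real^3^3 \<Rightarrow> proj_elem \<Rightarrow> proj_elem" where
  "act A (Point P) = Point (act_pt A P)"
| "act A (Line l) = Line (act_pt A ` l)"

text \<open>A line is preserved as a set of points, not necessarily pointwise.\<close>

definition preserves_each :: "(real^3^3) set \<Rightarrow> proj_elem set \<Rightarrow> bool" where
  "preserves_each G T \<longleftrightarrow> (\<forall>A\<in>G. \<forall>x\<in>T. act A x = x)"

definition SL3 :: "(real^3^3) monoid" where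
  "SL3 = \<lparr>carrier = {A. det A = 1}, mult = (**), one = mat 1\<rparr>"

text \<open>Matrices are given by the list of their rows.\<close>

definition mat3 :: "real list list \<Rightarrow> real^3^3" where
  "mat3 rs = vector (map vector rs)"

definition grp_C :: "(real^3^3) set" where
  "grp_C = {mat3 [[a, 0, 0], [0, b, 0], [0, 0, 1 / (a * b)]] | a b. 0 < a \<and> 0 < b}"

definition grp_F :: "(real^3^3) set" where
  "grp_F = {mat3 [[a, t, 0], [0, a, 0], [0, 0, 1 / a^2]] | a t. 0 < a}"

definition grp_N1 :: "(real^3^3) set" where
  "grp_N1 = {mat3 [[1, s, t], [0, 1, s], [0, 0, 1]] | s t. True}"

definition grp_N2 :: "(real^3^3) set" where
  "grp_N2 = {mat3 [[1, s, t], [0, 1, 0], [0, 0, 1]] | s t. True}"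

definition grp_N3 :: "(real^3^3) set" where
  "grp_N3 = {mat3 [[1, 0, t], [0, 1, s], [0, 0, 1]] | s t. True}"

definition Q :: "(real^3^3) set set" where
  "Q = {grp_C, grp_F, grp_N1, grp_N2, grp_N3}"

abbreviation e1 :: "real^3" where "e1 \<equiv> axis 1 1"
abbreviation e2 :: "real^3" where "e2 \<equiv> axis 2 1"
abbreviation e3 :: "real^3" where "e3 \<equiv> axis 3 1"

definition TC :: "proj_elem set" where
  "TC = {Point (pt e1), Point (pt e2), Point (pt e3),
         Line (line_through e1 e2), Line (line_through e1 e3), Line (line_through e2 e3)}"

definition TF :: "proj_elem set" where
  "TF = {Point (pt e1), Point (pt e3), Line (line_through e1 e3), Line (line_through e1 e2)}"

definition TN1 :: "proj_elem set" where
  "TN1 = {Point (pt e1), Line (line_through e1 e2)}"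

definition TN2 :: "proj_elem set" where
  "TN2 = {Point (pt e1), Line (line_through e1 e2), Line (line_through e1 e3),
          Line (line_through e1 (e2 + e3))}"

definition TN3 :: "proj_elem set" where
  "TN3 = {Line (line_through e1 e2), Point (pt e1), Point (pt e2), Point (pt (e1 + e2))}"

definition TQ :: "proj_elem set set" where
  "TQ = {TC, TF, TN1, TN2, TN3}"

definition maximal_in :: "'a set set \<Rightarrow> ('a set \<Rightarrow> bool) \<Rightarrow> 'a set \<Rightarrow> bool" where
  "maximal_in S P T \<longleftrightarrow> T \<in> S \<and> P T \<and> (\<forall>T'\<in>S. P T' \<and> T \<subseteq> T' \<longrightarrow> T' = T)"

lemma mat3_mult:
  "mat3 [[a,b,c],[d,e,f],[g,h,i]] ** mat3 [[a',b',c'],[d',e',f'],[g',h',i']] =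
   mat3 [[a*a'+b*d'+c*g', a*b'+b*e'+c*h', a*c'+b*f'+c*i'],
         [d*a'+e*d'+f*g', d*b'+e*e'+f*h', d*c'+e*f'+f*i'],
         [g*a'+h*d'+i*g', g*b'+h*e'+i*h', g*c'+h*f'+i*i']]"
  by (simp add: mat3_def vec_eq_iff matrix_matrix_mult_def sum_3 forall_3)

lemma mat3_one: "mat3 [[1,0,0],[0,1,0],[0,0,1]] = mat 1"
  by (simp add: mat3_def vec_eq_iff mat_def forall_3)

lemma det_mat3:
  "det (mat3 [[a,b,c],[d,e,f],[g,h,i]]) = a*e*i + b*f*g + c*d*h - a*f*h - b*d*i - c*e*g"
  by (simp add: mat3_def det_3)

lemma group_SL3: "group SL3"
proof (rule groupI)
  fix A assume A: "A \<in> carrier SL3"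
  then obtain B where "B ** A = mat 1"
    using invertible_det_nz[of A] by (auto simp: SL3_def invertible_def)
  moreover have "det B = 1"
    using A arg_cong[OF \<open>B ** A = mat 1\<close>, of det] by (simp add: SL3_def det_mul)
  ultimately show "\<exists>B\<in>carrier SL3. B \<otimes>\<^bsub>SL3\<^esub> A = \<one>\<^bsub>SL3\<^esub>"
    by (auto simp: SL3_def)
qed (auto simp: SL3_def det_mul matrix_mul_assoc)

lemma subgroup_SL3I:
  assumes "H \<subseteq> {A. det A = 1}" "mat 1 \<in> H"
    and mult: "\<And>A B. A \<in> H \<Longrightarrow> B \<in> H \<Longrightarrow> A ** B \<in> H"
    and inv: "\<And>A. A \<in> H \<Longrightarrow> \<exists>B\<in>H. B ** A = mat 1"
  shows "subgroup H SL3"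
proof (rule group.subgroupI[OF group_SL3])
  show "H \<subseteq> carrier SL3" using assms(1) by (simp add: SL3_def)
  show "H \<noteq> {}" using assms(2) by blast
  fix A assume A: "A \<in> H"
  obtain B where B: "B \<in> H" "B ** A = mat 1" using inv[OF A] by blast
  have "inv\<^bsub>SL3\<^esub> A = B"
    by (rule group.inv_equality[OF group_SL3]) (use A B assms(1) in \<open>auto simp: SL3_def\<close>)
  then show "inv\<^bsub>SL3\<^esub> A \<in> H" using B by simp
qed (simp add: SL3_def mult)

lemma grp_CI: "0 < a \<Longrightarrow> 0 < b \<Longrightarrow> mat3 [[a, 0, 0], [0, b, 0], [0, 0, 1 / (a * b)]] \<in> grp_C"
  unfolding grp_C_def by blast

lemma grp_FI: "0 < a \<Longrightarrow> mat3 [[a, t, 0], [0, a, 0], [0, 0, 1 / a^2]] \<in> grp_F"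
  unfolding grp_F_def by blast

lemma grp_N1I: "mat3 [[1, s, t], [0, 1, s], [0, 0, 1]] \<in> grp_N1"
  unfolding grp_N1_def by blast

lemma grp_N2I: "mat3 [[1, s, t], [0, 1, 0], [0, 0, 1]] \<in> grp_N2"
  unfolding grp_N2_def by blast

lemma grp_N3I: "mat3 [[1, 0, t], [0, 1, s], [0, 0, 1]] \<in> grp_N3"
  unfolding grp_N3_def by blast

lemma subgroup_C: "subgroup grp_C SL3"
proof (rule subgroup_SL3I)
  show "grp_C \<subseteq> {A. det A = 1}" by (auto simp: grp_C_def det_mat3)
  have "mat3 [[1, 0, 0], [0, 1, 0], [0, 0, 1 / (1 * 1)]] \<in> grp_C"
    by (intro grp_CI) simp_all
  then show "mat 1 \<in> grp_C" by (simp add: mat3_one)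
next
  fix A B assume "A \<in> grp_C" "B \<in> grp_C"
  then obtain a b c d where *: "0 < a" "0 < b" "0 < c" "0 < d"
    "A = mat3 [[a, 0, 0], [0, b, 0], [0, 0, 1 / (a * b)]]"
    "B = mat3 [[c, 0, 0], [0, d, 0], [0, 0, 1 / (c * d)]]" by (auto simp: grp_C_def)
  then have "A ** B = mat3 [[a * c, 0, 0], [0, b * d, 0], [0, 0, 1 / ((a * c) * (b * d))]]"
    by (simp add: mat3_mult mult_ac)
  moreover have "0 < a * c" "0 < b * d" using * by simp_all
  ultimately show "A ** B \<in> grp_C" by (simp add: grp_CI)
next
  fix A assume "A \<in> grp_C"
  then obtain a b where *: "0 < a" "0 < b"
    "A = mat3 [[a, 0, 0], [0, b, 0], [0, 0, 1 / (a * b)]]" by (auto simp: grp_C_def)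
  have "mat3 [[1/a, 0, 0], [0, 1/b, 0], [0, 0, 1 / (1/a * (1/b))]] \<in> grp_C"
    using * by (intro grp_CI) simp_all
  moreover have "mat3 [[1/a, 0, 0], [0, 1/b, 0], [0, 0, 1 / (1/a * (1/b))]] ** A = mat 1"
    using * by (simp add: mat3_mult mat3_one)
  ultimately show "\<exists>B\<in>grp_C. B ** A = mat 1" by blast
qed

lemma subgroup_F: "subgroup grp_F SL3"
proof (rule subgroup_SL3I)
  show "grp_F \<subseteq> {A. det A = 1}" by (auto simp: grp_F_def det_mat3 power2_eq_square)
  have "mat3 [[1, 0, 0], [0, 1, 0], [0, 0, 1 / 1^2]] \<in> grp_F"
    by (intro grp_FI) simp_all
  then show "mat 1 \<in> grp_F" by (simp add: mat3_one)
next
  fix A B assume "A \<in> grp_F" "B \<in> grp_F"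
  then obtain a t c u where *: "0 < a" "0 < c"
    "A = mat3 [[a, t, 0], [0, a, 0], [0, 0, 1 / a^2]]"
    "B = mat3 [[c, u, 0], [0, c, 0], [0, 0, 1 / c^2]]" by (auto simp: grp_F_def)
  then have "A ** B = mat3 [[a * c, a * u + t * c, 0], [0, a * c, 0], [0, 0, 1 / (a * c)^2]]"
    by (simp add: mat3_mult power_mult_distrib)
  moreover have "0 < a * c" using * by simp
  ultimately show "A ** B \<in> grp_F" by (simp add: grp_FI)
next
  fix A assume "A \<in> grp_F"
  then obtain a t where *: "0 < a"
    "A = mat3 [[a, t, 0], [0, a, 0], [0, 0, 1 / a^2]]" by (auto simp: grp_F_def)
  have "mat3 [[1/a, -t/a^2, 0], [0, 1/a, 0], [0, 0, 1 / (1/a)^2]] \<in> grp_F"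
    using * by (intro grp_FI) simp_all
  moreover have "mat3 [[1/a, -t/a^2, 0], [0, 1/a, 0], [0, 0, 1 / (1/a)^2]] ** A = mat 1"
    using * by (simp add: mat3_mult mat3_one power2_eq_square)
  ultimately show "\<exists>B\<in>grp_F. B ** A = mat 1" by blast
qed

lemma subgroup_N1: "subgroup grp_N1 SL3"
proof (rule subgroup_SL3I)
  show "grp_N1 \<subseteq> {A. det A = 1}" by (auto simp: grp_N1_def det_mat3)
  show "mat 1 \<in> grp_N1"
    unfolding mat3_one[symmetric] by (rule grp_N1I)
next
  fix A B assume "A \<in> grp_N1" "B \<in> grp_N1"
  then obtain s t s' t' where *: "A = mat3 [[1, s, t], [0, 1, s], [0, 0, 1]]"
    "B = mat3 [[1, s', t'], [0, 1, s'], [0, 0, 1]]" by (auto simp: grp_N1_def)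
  have "A ** B = mat3 [[1, s + s', t + s * s' + t'], [0, 1, s + s'], [0, 0, 1]]"
    by (simp add: * mat3_mult add_ac)
  then show "A ** B \<in> grp_N1" by (simp add: grp_N1I)
next
  fix A assume "A \<in> grp_N1"
  then obtain s t where *: "A = mat3 [[1, s, t], [0, 1, s], [0, 0, 1]]"
    by (auto simp: grp_N1_def)
  have "mat3 [[1, -s, s * s - t], [0, 1, -s], [0, 0, 1]] ** A = mat 1"
    by (simp add: * mat3_mult mat3_one)
  moreover have "mat3 [[1, -s, s * s - t], [0, 1, -s], [0, 0, 1]] \<in> grp_N1"
    by (rule grp_N1I)
  ultimately show "\<exists>B\<in>grp_N1. B ** A = mat 1" by blast
qed

lemma subgroup_N2: "subgroup grp_N2 SL3"
proof (rule subgroup_SL3I)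
  show "grp_N2 \<subseteq> {A. det A = 1}" by (auto simp: grp_N2_def det_mat3)
  show "mat 1 \<in> grp_N2"
    unfolding mat3_one[symmetric] by (rule grp_N2I)
next
  fix A B assume "A \<in> grp_N2" "B \<in> grp_N2"
  then obtain s t s' t' where *: "A = mat3 [[1, s, t], [0, 1, 0], [0, 0, 1]]"
    "B = mat3 [[1, s', t'], [0, 1, 0], [0, 0, 1]]" by (auto simp: grp_N2_def)
  have "A ** B = mat3 [[1, s + s', t + t'], [0, 1, 0], [0, 0, 1]]"
    by (simp add: * mat3_mult add_ac)
  then show "A ** B \<in> grp_N2" by (simp add: grp_N2I)
next
  fix A assume "A \<in> grp_N2"
  then obtain s t where *: "A = mat3 [[1, s, t], [0, 1, 0], [0, 0, 1]]"
    by (auto simp: grp_N2_def)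
  have "mat3 [[1, -s, -t], [0, 1, 0], [0, 0, 1]] ** A = mat 1"
    by (simp add: * mat3_mult mat3_one)
  moreover have "mat3 [[1, -s, -t], [0, 1, 0], [0, 0, 1]] \<in> grp_N2"
    by (rule grp_N2I)
  ultimately show "\<exists>B\<in>grp_N2. B ** A = mat 1" by blast
qed

lemma subgroup_N3: "subgroup grp_N3 SL3"
proof (rule subgroup_SL3I)
  show "grp_N3 \<subseteq> {A. det A = 1}" by (auto simp: grp_N3_def det_mat3)
  show "mat 1 \<in> grp_N3"
    unfolding mat3_one[symmetric] by (rule grp_N3I)
next
  fix A B assume "A \<in> grp_N3" "B \<in> grp_N3"
  then obtain s t s' t' where *: "A = mat3 [[1, 0, t], [0, 1, s], [0, 0, 1]]"
    "B = mat3 [[1, 0, t'], [0, 1, s'], [0, 0, 1]]" by (auto simp: grp_N3_def)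
  have "A ** B = mat3 [[1, 0, t + t'], [0, 1, s + s'], [0, 0, 1]]"
    by (simp add: * mat3_mult add_ac)
  then show "A ** B \<in> grp_N3" by (simp add: grp_N3I)
next
  fix A assume "A \<in> grp_N3"
  then obtain s t where *: "A = mat3 [[1, 0, t], [0, 1, s], [0, 0, 1]]"
    by (auto simp: grp_N3_def)
  have "mat3 [[1, 0, -t], [0, 1, -s], [0, 0, 1]] ** A = mat 1"
    by (simp add: * mat3_mult mat3_one)
  moreover have "mat3 [[1, 0, -t], [0, 1, -s], [0, 0, 1]] \<in> grp_N3"
    by (rule grp_N3I)
  ultimately show "\<exists>B\<in>grp_N3. B ** A = mat 1" by blast
qed

lemma Q_subgroups: "G \<in> Q \<Longrightarrow> subgroup G SL3"
  by (auto simp: Q_def subgroup_C subgroup_F subgroup_N1 subgroup_N2 subgroup_N3)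

lemma pt_in_RP2: "v \<noteq> 0 \<Longrightarrow> pt v \<in> RP2"
  by (simp add: pt_def RP2_def dim_span)

lemma line_through_in_proj_lines:
  assumes "independent {u, v}" "u \<noteq> v"
  shows "line_through u v \<in> proj_lines"
proof -
  have "dim (span {u, v}) = 2"
    using assms by (simp add: dim_span dim_eq_card_independent)
  then show ?thesis
    unfolding proj_lines_def line_through_def by (blast intro: subspace_span)
qed

lemma TQ_configurations: "T \<in> TQ \<Longrightarrow> configuration T"
proof -
  have nz: "e1 \<noteq> 0" "e2 \<noteq> 0" "e3 \<noteq> 0" "e1 + e2 \<noteq> 0"
    by (auto simp: vec_eq_iff axis_def forall_3)
  have ne: "e1 \<noteq> e2" "e1 \<noteq> e3" "e2 \<noteq> e3" "e1 \<noteq> e2 + e3"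
    by (auto simp: vec_eq_iff axis_def forall_3)
  have "independent {e1, e2}" "independent {e1, e3}" "independent {e2, e3}"
    "independent {e1, e2 + e3}"
    by (auto simp: independent_insert span_singleton vec_eq_iff axis_def forall_3)
  then have "line_through e1 e2 \<in> proj_lines" "line_through e1 e3 \<in> proj_lines"
    "line_through e2 e3 \<in> proj_lines" "line_through e1 (e2 + e3) \<in> proj_lines"
    using ne by (auto intro!: line_through_in_proj_lines)
  moreover have "pt e1 \<in> RP2" "pt e2 \<in> RP2" "pt e3 \<in> RP2" "pt (e1 + e2) \<in> RP2"
    using nz by (auto intro!: pt_in_RP2)
  ultimately show "T \<in> TQ \<Longrightarrow> configuration T"
    by (auto simp: TQ_def configuration_def TC_def TF_def TN1_def TN2_def TN3_def)
qed

end

theory Submission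
  imports Defs
begin

text \<open>
  For \<open>T\<close> in \<open>TQ\<close>, preservation of \<open>T\<close> by an invertible matrix amounts to the vanishing of a few
  linear forms in its entries. Evaluating these on the five groups shows that each \<open>G\<close> in \<open>Q\<close>
  has a greatest preserved configuration \<open>T\<^sub>G\<close>: a configuration of \<open>TQ\<close> is preserved by \<open>G\<close> iff it is
  contained in \<open>T\<^sub>G\<close>. The table of preserved pairs has pairwise distinct rows and pairwise distinct
  columns, so it also separates the groups from each other and the configurations from each other.
\<close>

lemma act_pt_pt: "act_pt A (pt v) = pt (A *v v)"
  using linear_span_image[OF matrix_vector_mul_linear[of A], of "{v}"]
  by (simp add: act_pt_def pt_def)

text \<open>Fixing a projective point means having \<open>v\<close> as an eigenvector. Invertibility
  excludes eigenvalue 0 for nonzero \<open>v\<close>, so the image of the span is the whole span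
  again.\<close>

lemma act_Point_eq_iff:
  fixes A :: "real^3^3"
  assumes "det A \<noteq> 0"
  shows "act A (Point (pt v)) = Point (pt v) \<longleftrightarrow> A *v v \<in> span {v}"
proof
  assume "act A (Point (pt v)) = Point (pt v)"
  then have "pt (A *v v) = pt v" by (simp add: act_pt_pt)
  then show "A *v v \<in> span {v}" by (metis pt_def insertI1 span_base)
next
  assume "A *v v \<in> span {v}"
  then obtain k where k: "A *v v = k *\<^sub>R v" by (auto simp: span_singleton)
  \<comment> \<open>The kernel of \<open>A\<close> is trivial; for \<open>k = 0\<close> both spans
    are therefore the zero subspace.\<close>
  have "v = 0" if "k = 0"
    using that k assms by (metis invertible_det_nz invertible_left_inverse
        matrix_left_invertible_ker scaleR_zero_left)
  then have "span {k *\<^sub>R v} = span {v}"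
    using span_image_scale[of "{v}" "\<lambda>_. k"] by (cases "k = 0") auto
  then show "act A (Point (pt v)) = Point (pt v)"
    by (simp only: act.simps act_pt_pt k) (simp add: pt_def)
qed

lemma inj_mult_vec_of_det:
  fixes A :: "real^'n^'n"
  assumes "det A \<noteq> 0"
  shows "inj ((*v) A)"
  using assms by (metis invertible_det_nz invertible_eq_bij bij_is_inj)

lemma act_pt_in_RP2:
  assumes "det A \<noteq> 0" "P \<in> RP2"
  shows "act_pt A P \<in> RP2"
proof -
  have "dim ((*v) A ` P) = dim P"
    by (intro dim_image_eq[OF matrix_vector_mul_linear]
        inj_on_subset[OF inj_mult_vec_of_det[OF assms(1)]]) simp
  then show ?thesis
    using assms(2) by (auto simp: RP2_def act_pt_def
        intro: linear_subspace_image[OF matrix_vector_mul_linear])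
qed

text \<open>A line is a set of points, so its invariance must be traded for that of the subspace
  \<open>span {u, v}\<close>: one way by testing the points spanned by \<open>u\<close> and
  \<open>v\<close>, the other way by a dimension count together with the inverse matrix.\<close>

lemma act_Line_eq_iff:
  assumes "det A \<noteq> 0"
  shows "act A (Line (line_through u v)) = Line (line_through u v) \<longleftrightarrow>
    A *v u \<in> span {u, v} \<and> A *v v \<in> span {u, v}"
proof
  assume "act A (Line (line_through u v)) = Line (line_through u v)"
  then have *: "act_pt A ` line_through u v = line_through u v" by simp
  have "A *v w \<in> span {u, v}" if w: "w \<in> {u, v}" for w
  \<comment> \<open>The zero vector spans no point of \<open>RP2\<close>, so the degenerate case is
    split off.\<close>
  proof (cases "w = 0")
    case False
    have "pt w \<subseteq> span {u, v}" using w unfolding pt_def by (intro span_mono) auto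
    with pt_in_RP2[OF False] have "pt w \<in> line_through u v"
      by (simp add: line_through_def)
    then have "pt (A *v w) \<in> line_through u v"
      using * act_pt_pt by (metis imageI)
    then show ?thesis by (auto simp: line_through_def pt_def intro: span_base)
  qed (simp add: span_zero)
  then show "A *v u \<in> span {u, v} \<and> A *v v \<in> span {u, v}" by simp
next
  let ?W = "span {u, v}"
  assume "A *v u \<in> ?W \<and> A *v v \<in> ?W"
  then have sub: "(*v) A ` ?W \<subseteq> ?W"
    unfolding linear_span_image[OF matrix_vector_mul_linear, symmetric]
    by (intro span_minimal) auto
  obtain B where BA: "B ** A = mat 1" and AB: "A ** B = mat 1"
    using assms by (auto simp: invertible_det_nz[symmetric] invertible_def)
  have "dim ((*v) A ` ?W) = dim ?W"
    by (intro dim_image_eq[OF matrix_vector_mul_linear]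
        inj_on_subset[OF inj_mult_vec_of_det[OF assms(1)]]) simp
  \<comment> \<open>An injective map keeps the dimension, so the inclusion is an equality.\<close>
  with sub have img: "(*v) A ` ?W = ?W"
    by (intro subspace_dim_equal linear_subspace_image[OF matrix_vector_mul_linear]) auto
  have "det A * det B = 1" using arg_cong[OF AB, of det] by (simp add: det_mul)
  then have detB: "det B \<noteq> 0" by auto
  have "(*v) B ` (*v) A ` ?W = ?W"
    by (simp add: image_image matrix_vector_mul_assoc BA)
  then have imgB: "(*v) B ` ?W = ?W" by (simp add: img)
  have "act_pt A ` line_through u v = line_through u v"
  proof
    show "act_pt A ` line_through u v \<subseteq> line_through u v"
      using img act_pt_in_RP2[OF assms] by (fastforce simp: line_through_def act_pt_def)
    \<comment> \<open>The inverse \<open>B\<close> also maps the plane onto itself, so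
      \<open>act_pt B P\<close> is a preimage of \<open>P\<close> on the line.\<close>
    show "line_through u v \<subseteq> act_pt A ` line_through u v"
    proof
      fix P assume P: "P \<in> line_through u v"
      have "act_pt B P \<in> line_through u v"
        using P imgB act_pt_in_RP2[OF detB] by (fastforce simp: line_through_def act_pt_def)
      moreover have "P = act_pt A (act_pt B P)"
        by (simp add: act_pt_def image_image matrix_vector_mul_assoc AB)
      ultimately show "P \<in> act_pt A ` line_through u v" by blast
    qed
  qed
  then show "act A (Line (line_through u v)) = Line (line_through u v)" by simp
qed

text \<open>The vector \<open>e2 + e3\<close> is included because the line through \<open>e1\<close>
  and \<open>e2 + e3\<close> is reduced to it below.\<close>

lemma in_span_singletons:
  fixes x :: "real^3"
  shows "x \<in> span {e1} \<longleftrightarrow> x$2 = 0 \<and> x$3 = 0"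
    and "x \<in> span {e2} \<longleftrightarrow> x$1 = 0 \<and> x$3 = 0"
    and "x \<in> span {e3} \<longleftrightarrow> x$1 = 0 \<and> x$2 = 0"
    and "x \<in> span {e1 + e2} \<longleftrightarrow> x$1 = x$2 \<and> x$3 = 0"
    and "x \<in> span {e2 + e3} \<longleftrightarrow> x$2 = x$3 \<and> x$1 = 0"
  by (auto simp: span_singleton vec_eq_iff forall_3 axis_def image_iff)

lemma in_span_pairs:
  fixes x :: "real^3"
  shows "x \<in> span {e1, e2} \<longleftrightarrow> x$3 = 0"
    and "x \<in> span {e1, e3} \<longleftrightarrow> x$2 = 0"
    and "x \<in> span {e2, e3} \<longleftrightarrow> x$1 = 0"
    and "x \<in> span {e1, e2 + e3} \<longleftrightarrow> x$2 = x$3"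
  \<comment> \<open>Subtracting a multiple of \<open>e1\<close> or \<open>e2\<close> reduces each
    plane to a singleton span; the multiple is the matching coordinate of \<open>x\<close>.\<close>
  by (simp_all only: span_breakdown_eq[where S = "{b}" for b] in_span_singletons)
     (auto simp: axis_def)

text \<open>The columns of \<open>A\<close> are the images of the basis vectors, which gives the
  vanishing entries. The line through \<open>e1\<close> and \<open>e2 + e3\<close> and the point of
  \<open>e1 + e2\<close> then give the equalities of diagonal entries. Membership in
  \<open>Q\<close> supplies determinant 1.\<close>

lemma preserves_each_TQ_iff:
  assumes "G \<in> Q"
  shows
    "preserves_each G TC \<longleftrightarrow> (\<forall>A\<in>G. A$1$2 = 0 \<and> A$1$3 = 0 \<and> A$2$1 = 0 \<and> A$2$3 = 0 \<and>
      A$3$1 = 0 \<and> A$3$2 = 0)" (is ?TC)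
    "preserves_each G TF \<longleftrightarrow> (\<forall>A\<in>G. A$2$1 = 0 \<and> A$3$1 = 0 \<and> A$1$3 = 0 \<and> A$2$3 = 0 \<and>
      A$3$2 = 0)" (is ?TF)
    "preserves_each G TN1 \<longleftrightarrow> (\<forall>A\<in>G. A$2$1 = 0 \<and> A$3$1 = 0 \<and> A$3$2 = 0)" (is ?TN1)
    "preserves_each G TN2 \<longleftrightarrow> (\<forall>A\<in>G. A$2$1 = 0 \<and> A$3$1 = 0 \<and> A$3$2 = 0 \<and> A$2$3 = 0 \<and>
      A$2$2 = A$3$3)" (is ?TN2)
    "preserves_each G TN3 \<longleftrightarrow> (\<forall>A\<in>G. A$2$1 = 0 \<and> A$3$1 = 0 \<and> A$3$2 = 0 \<and> A$1$2 = 0 \<and>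
      A$1$1 = A$2$2)" (is ?TN3)
proof -
  have "det A \<noteq> 0" if "A \<in> G" for A
    using subgroup.subset[OF Q_subgroups[OF assms]] that by (auto simp: SL3_def)
  note act_iff = act_Point_eq_iff[OF this] act_Line_eq_iff[OF this]
  show ?TC ?TF ?TN1 ?TN2 ?TN3
    unfolding preserves_each_def TC_def TF_def TN1_def TN2_def TN3_def
    by (auto simp del: act.simps simp: act_iff in_span_singletons in_span_pairs
        matrix_vector_right_distrib
        matrix_vector_mult_basis column_def)
qed

lemma preserves_each_table:
  "preserves_each grp_C TC" "preserves_each grp_C TF" "preserves_each grp_C TN1"
  "\<not> preserves_each grp_C TN2" "\<not> preserves_each grp_C TN3"
  "\<not> preserves_each grp_F TC" "preserves_each grp_F TF" "preserves_each grp_F TN1"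
  "\<not> preserves_each grp_F TN2" "\<not> preserves_each grp_F TN3"
  "\<not> preserves_each grp_N1 TC" "\<not> preserves_each grp_N1 TF" "preserves_each grp_N1 TN1"
  "\<not> preserves_each grp_N1 TN2" "\<not> preserves_each grp_N1 TN3"
  "\<not> preserves_each grp_N2 TC" "\<not> preserves_each grp_N2 TF" "preserves_each grp_N2 TN1"
  "preserves_each grp_N2 TN2" "\<not> preserves_each grp_N2 TN3"
  "\<not> preserves_each grp_N3 TC" "\<not> preserves_each grp_N3 TF" "preserves_each grp_N3 TN1"
  "\<not> preserves_each grp_N3 TN2" "preserves_each grp_N3 TN3"
proof -
  have Q: "grp_C \<in> Q" "grp_F \<in> Q" "grp_N1 \<in> Q" "grp_N2 \<in> Q" "grp_N3 \<in> Q"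
    by (simp_all add: Q_def)
  note iffs = Q[THEN preserves_each_TQ_iff(1)] Q[THEN preserves_each_TQ_iff(2)]
    Q[THEN preserves_each_TQ_iff(3)] Q[THEN preserves_each_TQ_iff(4)]
    Q[THEN preserves_each_TQ_iff(5)]
  show "preserves_each grp_C TC" "preserves_each grp_C TF" "preserves_each grp_C TN1"
    "preserves_each grp_F TF" "preserves_each grp_F TN1" "preserves_each grp_N1 TN1"
    "preserves_each grp_N2 TN1" "preserves_each grp_N2 TN2"
    "preserves_each grp_N3 TN1" "preserves_each grp_N3 TN3"
    unfolding iffs
    by (auto simp: grp_C_def grp_F_def grp_N1_def grp_N2_def grp_N3_def mat3_def)
  show "\<not> preserves_each grp_C TN2" "\<not> preserves_each grp_C TN3"
    \<comment> \<open>The witness is diagonal with three distinct entries 1, 2, 1/2.\<close>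
    unfolding iffs using grp_CI[of 1 2] by (force simp: mat3_def)+
  show "\<not> preserves_each grp_F TC" "\<not> preserves_each grp_F TN2"
    "\<not> preserves_each grp_F TN3"
    \<comment> \<open>Here \<open>t = 1\<close> violates \<open>A$1$2 = 0\<close>, and
      \<open>a = 2\<close> separates \<open>a\<close> from \<open>1 / a^2\<close>.\<close>
    unfolding iffs using grp_FI[of 2 1] by (force simp: mat3_def)+
  show "\<not> preserves_each grp_N1 TC" "\<not> preserves_each grp_N1 TF"
    "\<not> preserves_each grp_N1 TN2" "\<not> preserves_each grp_N1 TN3"
    \<comment> \<open>In the three unipotent groups, \<open>s = t = 1\<close> makes every free
      off-diagonal entry nonzero.\<close>
    unfolding iffs using grp_N1I[of 1 1] by (force simp: mat3_def)+
  show "\<not> preserves_each grp_N2 TC" "\<not> preserves_each grp_N2 TF"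
    "\<not> preserves_each grp_N2 TN3"
    unfolding iffs using grp_N2I[of 1 1] by (force simp: mat3_def)+
  show "\<not> preserves_each grp_N3 TC" "\<not> preserves_each grp_N3 TF"
    "\<not> preserves_each grp_N3 TN2"
    unfolding iffs using grp_N3I[of 1 1] by (force simp: mat3_def)+
qed

text \<open>Inclusion is only a partial order, so maximal elements could be several; a greatest one
  excludes all others, which makes the correspondence single-valued.\<close>

lemma maximal_in_iff_greatest:
  assumes "T0 \<in> S" "P T0" "\<And>T. T \<in> S \<Longrightarrow> P T \<Longrightarrow> T \<subseteq> T0"
  shows "maximal_in S P T \<longleftrightarrow> T = T0"
  using assms unfolding maximal_in_def by (metis subset_antisym)

theorem theorem2:
  shows "\<exists>\<theta>. bij_betw \<theta> Q TQ \<and>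
    (\<forall>G\<in>Q. \<forall>T\<in>TQ. \<theta> G = T \<longleftrightarrow>
       preserves_each G T \<and> maximal_in TQ (preserves_each G) T)"
proof -
  have ne: "grp_C \<noteq> grp_F" "grp_C \<noteq> grp_N1" "grp_C \<noteq> grp_N2" "grp_C \<noteq> grp_N3"
    "grp_F \<noteq> grp_N1" "grp_F \<noteq> grp_N2" "grp_F \<noteq> grp_N3"
    "grp_N1 \<noteq> grp_N2" "grp_N1 \<noteq> grp_N3" "grp_N2 \<noteq> grp_N3"
    using preserves_each_table by metis+
  have neT: "TC \<noteq> TF" "TC \<noteq> TN1" "TC \<noteq> TN2" "TC \<noteq> TN3" "TF \<noteq> TN1" "TF \<noteq> TN2" "TF \<noteq> TN3"
    "TN1 \<noteq> TN2" "TN1 \<noteq> TN3" "TN2 \<noteq> TN3"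
    using preserves_each_table by metis+
  \<comment> \<open>These are the proper inclusions that the table calls for: each preserved
    configuration lies in the greatest one of its row.\<close>
  have sub: "TF \<subseteq> TC" "TN1 \<subseteq> TC" "TN1 \<subseteq> TF" "TN1 \<subseteq> TN2" "TN1 \<subseteq> TN3"
    by (auto simp: TC_def TF_def TN1_def TN2_def TN3_def)
  \<comment> \<open>The last branch serves \<open>grp_N3\<close> and makes \<open>TN3\<close> the
    default value outside \<open>Q\<close>.\<close>
  define \<theta> where "\<theta> G = (if G = grp_C then TC else if G = grp_F then TF
    else if G = grp_N1 then TN1 else if G = grp_N2 then TN2 else TN3)" for G
  have \<theta>: "\<theta> grp_C = TC" "\<theta> grp_F = TF" "\<theta> grp_N1 = TN1" "\<theta> grp_N2 = TN2" "\<theta> grp_N3 = TN3"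
    using ne by (auto simp: \<theta>_def)
  have "bij_betw \<theta> Q TQ"
    using neT by (auto simp: bij_betw_def inj_on_def Q_def TQ_def \<theta>)
  moreover have "maximal_in TQ (preserves_each G) T \<longleftrightarrow> T = \<theta> G" if "G \<in> Q" for G T
    using that by (intro maximal_in_iff_greatest)
      (auto simp: Q_def TQ_def \<theta> preserves_each_table dest: sub[THEN subsetD])
  ultimately show ?thesis by (metis maximal_in_def)
qed

end
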